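(* Let $1\le p<\infty$ and $\phi\in\mathscr{G}_p$. The generalized Morrey space $\mathcal{M}^{p,\phi}(\mathbb{R}^d)$, equipped with the norm $\|\cdot\|_{\mathcal{M}^{p,\phi}}$, is a Banach space.
   Context: Let $d\ge1$ be an integer and $0<n\le d$. $\mathbb{R}^d$ is equipped with a Borel measure $\mu$ satisfying the growth condition of order $n$: there is a constant $C>0$ such that $\mu(B(a,r))\le Cr^n$ for every ball $B(a,r)=\{x\in\mathbb{R}^d:|x-a|<r\}$, $a\in\mathbb{R}^d$, $r>0$. For $1\le p<\infty$, $\mathscr{G}_p$ is the set of all functions $\phi:(0,\infty)\to(0,\infty)$ such that $\phi$ is almost decreasing (there is $C>0$ such that $r\le s$ implies $\phi(r)\ge C\phi(s)$) and $t\mapsto t^{n/p}\phi(t)$ is almost increasing (there is $C>0$ such that $r\le s$ implies $r^{n/p}\phi(r)\le Cs^{n/p}\phi(s)$). For $1\le p<\infty$ and $\phi\in\mathscr{G}_p$, the generalized Morrey space is $\mathcal{M}^{p,\phi}(\mathbb{R}^d)=\{f\in L_p(\mathbb{R}^d,\mu):\|f\|_{\mathcal{M}^{p,\phi}}<\infty\}$ (functions identified when equal $\mu$-almost everywhere), where $$\|f\|_{\mathcal{M}^{p,\phi}}=\sup_{a\in\mathbb{R}^d,\,r>0}\frac{1}{\phi(r)}\left(\frac{1}{r^n}\int_{B(a,r)}|f(x)|^p\,d\mu(x)\right)^{1/p}.$$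
   Formalization: The functions are required to be locally p-integrable instead of in global L_p(ℝ^d,μ); with global L_p completeness fails, e.g. for Lebesgue measure with d=n=p=1, φ=1, where truncations of 1/(1+|x|) are Cauchy but the limit is not integrable. *)

theory Defs
  imports "HOL-Analysis.Analysis" "HOL-Algebra.Module"
begin

section \<open>Banach spaces with an explicit carrier\<close>

definition scalar_ring :: "'k::real_normed_field ring" where
  "scalar_ring = \<lparr>carrier = UNIV, monoid.mult = (*), one = 1, ring.zero = 0, add = (+)\<rparr>"

locale normed_space = module scalar_ring V
  for V :: "('k::real_normed_field, 'v) module" (structure) +
  fixes nrm :: "'v \<Rightarrow> real"
  assumes nrm_nonneg: "x \<in> carrier V \<Longrightarrow> 0 \<le> nrm x"
    and nrm_eq_0_iff: "x \<in> carrier V \<Longrightarrow> nrm x = 0 \<longleftrightarrow> x = \<zero>\<^bsub>V\<^esub>"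
    and nrm_smult: "x \<in> carrier V \<Longrightarrow> nrm (c \<odot>\<^bsub>V\<^esub> x) = norm c * nrm x"
    and nrm_triangle:
      "\<lbrakk>x \<in> carrier V; y \<in> carrier V\<rbrakk> \<Longrightarrow> nrm (x \<oplus>\<^bsub>V\<^esub> y) \<le> nrm x + nrm y"
begin

text \<open>The value outside the carrier is irrelevant; it is set to 0 because
  \<^locale>\<open>Metric_space\<close> wants a distance that is nonnegative and symmetric on the whole type.\<close>

definition nrm_dist :: "'v \<Rightarrow> 'v \<Rightarrow> real" where
  "nrm_dist x y = (if x \<in> carrier V \<and> y \<in> carrier V then nrm (x \<ominus>\<^bsub>V\<^esub> y) else 0)"

lemma nrm_a_inv:
  assumes x: "x \<in> carrier V"
  shows "nrm (\<ominus>\<^bsub>V\<^esub> x) = nrm x"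
proof -
  have c: "(-1::'k) \<in> carrier scalar_ring" "(1::'k) \<in> carrier scalar_ring"
    by (auto simp: scalar_ring_def)
  have one: "1 \<odot>\<^bsub>V\<^esub> x = x"
    using smult_one[OF x] by (simp add: scalar_ring_def)
  have "(-1 + 1) \<odot>\<^bsub>V\<^esub> x = (-1) \<odot>\<^bsub>V\<^esub> x \<oplus>\<^bsub>V\<^esub> 1 \<odot>\<^bsub>V\<^esub> x"
    using smult_l_distr[OF c x] by (simp add: scalar_ring_def)
  moreover have "0 \<odot>\<^bsub>V\<^esub> x = \<zero>\<^bsub>V\<^esub>"
    using nrm_smult[OF x, of 0] nrm_eq_0_iff[of "0 \<odot>\<^bsub>V\<^esub> x"] smult_closed[OF _ x, of 0]
    by (simp add: scalar_ring_def)
  ultimately have "(-1) \<odot>\<^bsub>V\<^esub> x \<oplus>\<^bsub>V\<^esub> x = \<zero>\<^bsub>V\<^esub>"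
    by (simp add: one)
  then have "\<ominus>\<^bsub>V\<^esub> x = (-1) \<odot>\<^bsub>V\<^esub> x"
    using M.minus_equality[OF _ x smult_closed[OF c(1) x]] by simp
  then show ?thesis
    using nrm_smult[OF x, of "-1"] by simp
qed

sublocale nrm_metric: Metric_space "carrier V" nrm_dist
proof
  fix x y
  show "0 \<le> nrm_dist x y"
    by (auto simp: nrm_dist_def intro: nrm_nonneg)
  show "nrm_dist x y = nrm_dist y x"
    using nrm_a_inv[of "x \<ominus>\<^bsub>V\<^esub> y"]
    by (auto simp: nrm_dist_def M.minus_eq M.minus_add M.a_comm)
  show "nrm_dist x y = 0 \<longleftrightarrow> x = y" if xy: "x \<in> carrier V" "y \<in> carrier V"
  proof -
    have "x \<ominus>\<^bsub>V\<^esub> y = \<zero>\<^bsub>V\<^esub> \<longleftrightarrow> x = y"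
      using xy M.minus_equality[of x "\<ominus>\<^bsub>V\<^esub> y"] by (auto simp: M.minus_eq M.r_neg)
    then show ?thesis
      using xy nrm_eq_0_iff[of "x \<ominus>\<^bsub>V\<^esub> y"] by (simp add: nrm_dist_def)
  qed
  fix z
  assume xyz: "x \<in> carrier V" "y \<in> carrier V" "z \<in> carrier V"
  have "x \<ominus>\<^bsub>V\<^esub> z = (x \<ominus>\<^bsub>V\<^esub> y) \<oplus>\<^bsub>V\<^esub> (y \<ominus>\<^bsub>V\<^esub> z)"
    using xyz by (simp add: M.minus_eq M.a_assoc M.r_neg1)
  then show "nrm_dist x z \<le> nrm_dist x y + nrm_dist y z"
    using xyz nrm_triangle[of "x \<ominus>\<^bsub>V\<^esub> y" "y \<ominus>\<^bsub>V\<^esub> z"] by (simp add: nrm_dist_def)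
qed

end

locale banach_space = normed_space +
  assumes complete: "nrm_metric.mcomplete"


section \<open>Generalized Morrey spaces\<close>

definition growth_condition :: "real \<Rightarrow> ('a::metric_space) measure \<Rightarrow> bool" where
  "growth_condition n \<mu> \<longleftrightarrow>
     (\<exists>C>0. \<forall>a r. 0 < r \<longrightarrow> emeasure \<mu> (ball a r) \<le> ennreal (C * r powr n))"

definition almost_decreasing :: "(real \<Rightarrow> real) \<Rightarrow> bool" where
  "almost_decreasing \<phi> \<longleftrightarrow> (\<exists>C>0. \<forall>r s. 0 < r \<longrightarrow> r \<le> s \<longrightarrow> C * \<phi> s \<le> \<phi> r)"

definition almost_increasing :: "(real \<Rightarrow> real) \<Rightarrow> bool" where
  "almost_increasing \<phi> \<longleftrightarrow> (\<exists>C>0. \<forall>r s. 0 < r \<longrightarrow> r \<le> s \<longrightarrow> \<phi> r \<le> C * \<phi> s)"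

text \<open>Functions on the half-line \<open>(0,\<infinity>)\<close> are represented by functions on the reals whose values
  at arguments \<open>\<le> 0\<close> are never used.\<close>

definition growth_functions :: "real \<Rightarrow> real \<Rightarrow> (real \<Rightarrow> real) set" where
  "growth_functions n p =
     {\<phi>. (\<forall>t>0. 0 < \<phi> t) \<and> almost_decreasing \<phi> \<and> almost_increasing (\<lambda>t. t powr (n / p) * \<phi> t)}"

definition Lp_loc ::
  "real \<Rightarrow> ('a::euclidean_space) measure \<Rightarrow> ('a \<Rightarrow> 'k::real_normed_field) set" where
  "Lp_loc p \<mu> = {f \<in> borel_measurable \<mu>.
     \<forall>K. compact K \<longrightarrow> set_integrable \<mu> K (\<lambda>x. norm (f x) powr p)}"

definition morrey_seminorm ::
  "real \<Rightarrow> real \<Rightarrow> (real \<Rightarrow> real) \<Rightarrow> ('a::euclidean_space) measure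
    \<Rightarrow> ('a \<Rightarrow> 'k::real_normed_field) \<Rightarrow> ennreal" where
  "morrey_seminorm n p \<phi> \<mu> f =
     (SUP (a, r) \<in> UNIV \<times> {0<..}.
        ennreal (1 / \<phi> r * (1 / r powr n * (LINT x:ball a r|\<mu>. norm (f x) powr p)) powr (1 / p)))"

text \<open>The functions are required to be \<^emph>\<open>locally\<close> \<open>p\<close>-integrable, which is the reading of
  \<open>L\<^sub>p\<close> under which the space is complete. With global \<open>p\<close>-integrability completeness fails:
  for Lebesgue measure on the line, \<open>n = p = 1\<close> and \<open>\<phi> = 1\<close>, the norm is twice the essential
  supremum, and \<open>f\<^sub>k(x) = 1 / (1 + |x|)\<close> for \<open>|x| < k\<close>, \<open>0\<close> otherwise, is a Cauchy sequence whose
  uniform limit is not integrable.\<close>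

definition morrey_functions ::
  "real \<Rightarrow> real \<Rightarrow> (real \<Rightarrow> real) \<Rightarrow> ('a::euclidean_space) measure
    \<Rightarrow> ('a \<Rightarrow> 'k::real_normed_field) set" where
  "morrey_functions n p \<phi> \<mu> = {f \<in> Lp_loc p \<mu>. morrey_seminorm n p \<phi> \<mu> f < \<infinity>}"

definition morrey_rel ::
  "real \<Rightarrow> real \<Rightarrow> (real \<Rightarrow> real) \<Rightarrow> ('a::euclidean_space) measure
    \<Rightarrow> ('a \<Rightarrow> 'k::real_normed_field) rel" where
  "morrey_rel n p \<phi> \<mu> = {(f, g). f \<in> morrey_functions n p \<phi> \<mu> \<and> g \<in> morrey_functions n p \<phi> \<mu> \<and>
     (AE x in \<mu>. f x = g x)}"

text \<open>The ring multiplication inherited by the record type \<^typ>\<open>('k, 'v) module\<close> plays no role in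
  a module and is left undefined.\<close>

definition morrey_space ::
  "real \<Rightarrow> real \<Rightarrow> (real \<Rightarrow> real) \<Rightarrow> ('a::euclidean_space) measure
    \<Rightarrow> ('k::real_normed_field, ('a \<Rightarrow> 'k) set) module" where
  "morrey_space n p \<phi> \<mu> =
     \<lparr>carrier = morrey_functions n p \<phi> \<mu> // morrey_rel n p \<phi> \<mu>,
      monoid.mult = undefined, one = undefined,
      ring.zero = morrey_rel n p \<phi> \<mu> `` {\<lambda>x. 0},
      add = (\<lambda>F G. \<Union>f\<in>F. \<Union>g\<in>G. morrey_rel n p \<phi> \<mu> `` {\<lambda>x. f x + g x}),
      smult = (\<lambda>c F. \<Union>f\<in>F. morrey_rel n p \<phi> \<mu> `` {\<lambda>x. c * f x})\<rparr>"

definition morrey_norm ::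
  "real \<Rightarrow> real \<Rightarrow> (real \<Rightarrow> real) \<Rightarrow> ('a::euclidean_space) measure
    \<Rightarrow> ('a \<Rightarrow> 'k::real_normed_field) set \<Rightarrow> real" where
  "morrey_norm n p \<phi> \<mu> F = the_elem ((\<lambda>f. enn2real (morrey_seminorm n p \<phi> \<mu> f)) ` F)"

end

theory Submission
  imports Defs
begin

text \<open>
  A bound \<open>c\<close> on the Morrey norm of \<open>f\<close> is the same as the family of ball estimates
  \<open>\<integral>\<^bsub>B(a,r)\<^esub> |f|\<^sup>p d\<mu> \<le> (c \<phi>(r) r\<^bsup>n/p\<^esup>)\<^sup>p\<close>, so the norm of \<open>f\<close> is the least such \<open>c\<close>
  (\<open>morrey_value_le_iff\<close>). Every property of the norm therefore reduces to a property of the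
  \<open>p\<close>-norm on one ball. On a ball the triangle inequality is Minkowski's inequality, which
  comes from the convexity of \<open>t\<^sup>p\<close>: with \<open>A\<close>, \<open>B\<close> bounding the two \<open>p\<close>-norms, write
  \<open>|f| + |g|\<close> as \<open>A + B\<close> times a convex combination of \<open>|f|/A\<close> and \<open>|g|/B\<close> and integrate.

  Completeness is the Riesz--Fischer argument, run on all balls at once. Out of a Cauchy sequence
  choose functions \<open>h\<^sub>j\<close> whose consecutive differences have Morrey norm at most \<open>4\<^bsup>-j\<^esup>\<close>. On a fixed
  ball the functions \<open>(2\<^sup>j |h\<^bsub>j+1\<^esub> - h\<^sub>j|)\<^sup>p\<close> then have summable integrals, hence a finite sum almost
  everywhere; so at almost every point \<open>|h\<^bsub>j+1\<^esub> - h\<^sub>j|\<close> is at most a constant times \<open>2\<^bsup>-j\<^esup>\<close>, and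
  \<open>h\<^sub>j\<close> converges there. Countably many balls cover the space
  (\<open>AE_convergent_if_rapidly_Cauchy\<close>). The pointwise limit \<open>g\<close> is also the limit in norm: by Fatou's
  lemma on each ball, the bounds for \<open>f\<^sub>m - h\<^sub>j\<close> pass to \<open>f\<^sub>m - g\<close> (\<open>morrey_bound_tendsto_AE\<close>).

  All of this concerns functions. Passing to classes modulo equality almost everywhere is formal,
  since the operations and the norm are computed on any representative.
\<close>


section \<open>Minkowski's inequality\<close>

text \<open>The second derivative gives convexity of \<open>t\<^sup>p\<close> on the open half-line only. If one of the points is
  0, the inequality reads \<open>(s w)\<^sup>p \<le> s w\<^sup>p\<close> and follows from \<open>s\<^sup>p \<le> s\<close> for \<open>s\<close> in the unit interval.\<close>

lemma powr_convex_combination_le: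
  fixes p t u v :: real
  assumes "1 \<le> p" "0 \<le> t" "t \<le> 1" "0 \<le> u" "0 \<le> v"
  shows "(t * u + (1 - t) * v) powr p \<le> t * u powr p + (1 - t) * v powr p"
proof -
  have scale: "(s * w) powr p \<le> s * w powr p" if "0 \<le> s" "s \<le> 1" "0 \<le> w" for s w :: real
  proof -
    have "s powr p \<le> s"
      using that assms(1) by (cases "s = 0") (auto intro: powr_le_one_le)
    then show ?thesis
      using that by (simp add: powr_mult mult_right_mono)
  qed
  consider "u = 0" | "v = 0" | "0 < u" "0 < v"
    using assms by linarith
  then show ?thesis
  proof cases
    case 3
    then show ?thesis
      using convex_onD[OF powr_convex[OF \<open>1 \<le> p\<close>], of "1 - t" u v] assms by simp
  qed (use scale[of "1 - t" v] scale[of t u] assms in auto)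
qed

text \<open>The pointwise form of Minkowski's inequality: after division by \<open>(A + B)\<^sup>p\<close> this is convexity of
  \<open>t\<^sup>p\<close> at the points \<open>x / A\<close> and \<open>y / B\<close> with weights \<open>A / (A + B)\<close> and \<open>B / (A + B)\<close>. If \<open>x\<^sup>p\<close> and
  \<open>y\<^sup>p\<close> integrate to at most \<open>A\<^sup>p\<close> and \<open>B\<^sup>p\<close>, the right-hand side integrates to at most
  \<open>(A + B)\<^sup>p\<close>.\<close>

lemma powr_add_le:
  fixes p A B x y :: real
  assumes "1 \<le> p" "0 < A" "0 < B" "0 \<le> x" "0 \<le> y"
  shows "(x + y) powr p \<le>
    (A + B) powr p * (A / (A + B) * (x powr p / A powr p) + B / (A + B) * (y powr p / B powr p))"
proof -
  define t where "t = A / (A + B)"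
  have t: "0 \<le> t" "t \<le> 1" and t': "1 - t = B / (A + B)"
    using assms by (auto simp: t_def field_simps)
  have "t * (x / A) = x / (A + B)" "(1 - t) * (y / B) = y / (A + B)"
    using assms unfolding t' unfolding t_def by simp_all
  then have "x + y = (A + B) * (t * (x / A) + (1 - t) * (y / B))"
    using assms by (simp flip: add_divide_distrib)
  then have "(x + y) powr p = (A + B) powr p * (t * (x / A) + (1 - t) * (y / B)) powr p"
    using assms t by (metis powr_mult)
  also have "\<dots> \<le> (A + B) powr p * (t * (x / A) powr p + (1 - t) * (y / B) powr p)"
    using assms t by (intro mult_left_mono powr_convex_combination_le) auto
  finally show ?thesis
    using assms unfolding t' unfolding t_def by (simp add: powr_divide)
qed

text \<open>Minkowski's inequality stated with upper bounds in place of the norms themselves. The bounds can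
  be enlarged to be positive, so a vanishing norm needs no separate treatment.\<close>

lemma nn_integral_powr_norm_add_le:
  fixes f g :: "'a \<Rightarrow> 'k::{real_normed_field, euclidean_space}"
  assumes p: "1 \<le> p" and AB: "0 < A" "0 < B"
    and [measurable]: "f \<in> borel_measurable M" "g \<in> borel_measurable M" "D \<in> sets M"
    and f: "(\<integral>\<^sup>+x\<in>D. ennreal (norm (f x) powr p) \<partial>M) \<le> ennreal (A powr p)"
    and g: "(\<integral>\<^sup>+x\<in>D. ennreal (norm (g x) powr p) \<partial>M) \<le> ennreal (B powr p)"
  shows "(\<integral>\<^sup>+x\<in>D. ennreal (norm (f x + g x) powr p) \<partial>M) \<le> ennreal ((A + B) powr p)"
proof -
  define a where "a = (A + B) powr p * (A / (A + B) / A powr p)"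
  define b where "b = (A + B) powr p * (B / (A + B) / B powr p)"
  have ab: "0 \<le> a" "0 \<le> b"
    using AB by (auto simp: a_def b_def)
  have pt: "norm (f x + g x) powr p \<le> a * norm (f x) powr p + b * norm (g x) powr p" for x
  proof -
    have "norm (f x + g x) powr p \<le> (norm (f x) + norm (g x)) powr p"
      using p by (intro powr_mono2 norm_triangle_ineq) auto
    also have "\<dots> \<le> a * norm (f x) powr p + b * norm (g x) powr p"
      using powr_add_le[OF p AB, of "norm (f x)" "norm (g x)"]
      by (simp add: a_def b_def algebra_simps)
    finally show ?thesis .
  qed
  have "(\<integral>\<^sup>+x\<in>D. ennreal (norm (f x + g x) powr p) \<partial>M)
      \<le> (\<integral>\<^sup>+x. ennreal a * (ennreal (norm (f x) powr p) * indicator D x)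
            + ennreal b * (ennreal (norm (g x) powr p) * indicator D x) \<partial>M)"
    using pt ab
    by (intro nn_integral_mono)
       (auto simp: indicator_def ennreal_mult'[symmetric] ennreal_plus[symmetric] intro!: ennreal_leI simp del: ennreal_plus)
  also have "\<dots> = ennreal a * (\<integral>\<^sup>+x\<in>D. ennreal (norm (f x) powr p) \<partial>M)
      + ennreal b * (\<integral>\<^sup>+x\<in>D. ennreal (norm (g x) powr p) \<partial>M)"
    by (simp add: nn_integral_add nn_integral_cmult)
  also have "\<dots> \<le> ennreal a * ennreal (A powr p) + ennreal b * ennreal (B powr p)"
    using f g by (intro add_mono mult_left_mono) auto
  also have "\<dots> = ennreal (a * A powr p + b * B powr p)"
    using ab by (simp add: ennreal_mult)
  also have "a * A powr p + b * B powr p = (A + B) powr p * ((A + B) / (A + B))"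
    using AB unfolding a_def b_def add_divide_distrib by (simp add: distrib_left)
  also have "\<dots> = (A + B) powr p"
    using AB by simp
  finally show ?thesis .
qed

section \<open>Morrey bounds as ball estimates\<close>

text \<open>This turns the quotient under the supremum of the Morrey norm into an estimate of the integral
  \<open>I\<close>, in which the \<open>p\<close>-th root has disappeared.\<close>

lemma ball_bound_iff:
  fixes p n r w c I :: real
  assumes "1 \<le> p" "0 < r" "0 < w" "0 \<le> c" "0 \<le> I"
  shows "1 / w * (1 / r powr n * I) powr (1 / p) \<le> c \<longleftrightarrow> I \<le> (c * w * r powr (n / p)) powr p"
proof -
  define J where "J = (1 / r powr n * I) powr (1 / p)"
  have J: "0 \<le> J" "J powr p = I / r powr n"
    using assms by (auto simp: J_def powr_powr)
  have "1 / w * J \<le> c \<longleftrightarrow> J \<le> c * w"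
    using assms by (simp add: field_simps)
  also have "\<dots> \<longleftrightarrow> J powr p \<le> (c * w) powr p"
    using assms J by (meson mult_nonneg_nonneg less_imp_le not_le powr_less_mono2 powr_mono2
      order_less_le_trans zero_le_one zero_less_one)
  also have "\<dots> \<longleftrightarrow> I \<le> (c * w) powr p * r powr n"
    using assms J by (simp add: pos_divide_le_eq)
  also have "(c * w) powr p * r powr n = (c * w * r powr (n / p)) powr p"
    using assms by (simp add: powr_mult powr_powr)
  finally show ?thesis
    by (simp add: J_def)
qed

lemma ball_in_sets_borel [measurable]: "ball a r \<in> sets (borel :: 'a::metric_space measure)"
  by simp

locale morrey =
  fixes n p :: real and \<phi> :: "real \<Rightarrow> real" and \<mu> :: "'a::euclidean_space measure"
  assumes sets_eq_borel [measurable_cong]: "sets \<mu> = sets borel"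
    and p_ge_1: "1 \<le> p"
    and phi_pos: "0 < t \<Longrightarrow> 0 < \<phi> t"
begin

abbreviation morreys :: "('a \<Rightarrow> 'k::{real_normed_field, euclidean_space}) set" where
  "morreys \<equiv> morrey_functions n p \<phi> \<mu>"

text \<open>The integral is the nonnegative one, so that finiteness, hence local \<open>p\<close>-integrability, is part
  of the bound instead of a precondition for reading the integral.\<close>

definition morrey_bound :: "real \<Rightarrow> ('a \<Rightarrow> 'k::{real_normed_field, euclidean_space}) \<Rightarrow> bool" where
  "morrey_bound c f \<longleftrightarrow> f \<in> borel_measurable \<mu> \<and>
     (\<forall>a r. 0 < r \<longrightarrow> (\<integral>\<^sup>+x\<in>ball a r. ennreal (norm (f x) powr p) \<partial>\<mu>)
        \<le> ennreal ((c * \<phi> r * r powr (n / p)) powr p))"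

definition morrey_value :: "('a \<Rightarrow> 'k::{real_normed_field, euclidean_space}) \<Rightarrow> real" where
  "morrey_value f = enn2real (morrey_seminorm n p \<phi> \<mu> f)"

lemma morrey_value_nonneg: "0 \<le> morrey_value f"
  by (simp add: morrey_value_def)

lemma morrey_boundD:
  assumes "morrey_bound c f" "0 < r"
  shows "(\<integral>\<^sup>+x\<in>ball a r. ennreal (norm (f x) powr p) \<partial>\<mu>)
    \<le> ennreal ((c * \<phi> r * r powr (n / p)) powr p)"
  using assms by (auto simp: morrey_bound_def)

lemma morrey_bound_measurable: "morrey_bound c f \<Longrightarrow> f \<in> borel_measurable \<mu>"
  by (simp add: morrey_bound_def)

text \<open>A compact set lies in a ball, on which the bound makes the integral finite.\<close>

lemma morrey_bound_imp_Lp_loc: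
  assumes f: "morrey_bound c f"
  shows "f \<in> Lp_loc p \<mu>"
  unfolding Lp_loc_def mem_Collect_eq
proof (intro conjI allI impI)
  show [measurable]: "f \<in> borel_measurable \<mu>"
    using f by (rule morrey_bound_measurable)
  fix K :: "'a set"
  assume K: "compact K"
  then obtain r where r: "0 < r" "K \<subseteq> ball 0 r"
    using bounded_subset_ballD[OF compact_imp_bounded] by blast
  have "set_integrable \<mu> (ball 0 r) (\<lambda>x. norm (f x) powr p)"
    unfolding set_integrable_def
  proof (rule integrableI_bounded)
    have "(\<integral>\<^sup>+x. ennreal (norm (indicat_real (ball 0 r) x *\<^sub>R norm (f x) powr p)) \<partial>\<mu>)
        = (\<integral>\<^sup>+x\<in>ball 0 r. ennreal (norm (f x) powr p) \<partial>\<mu>)"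
      by (intro nn_integral_cong) (auto simp: indicator_def)
    also have "\<dots> < \<infinity>"
      using morrey_boundD[OF f r(1), of 0] by (simp add: order_le_less_trans)
    finally show "(\<integral>\<^sup>+x. ennreal (norm (indicat_real (ball 0 r) x *\<^sub>R norm (f x) powr p)) \<partial>\<mu>) < \<infinity>" .
  qed measurable
  then show "set_integrable \<mu> K (\<lambda>x. norm (f x) powr p)"
    by (rule set_integrable_subset) (use K r in \<open>auto simp: sets_eq_borel borel_compact\<close>)
qed

lemma nn_integral_ball_eq:
  assumes f: "f \<in> Lp_loc p \<mu>"
  shows "(\<integral>\<^sup>+x\<in>ball a r. ennreal (norm (f x) powr p) \<partial>\<mu>)
    = ennreal (LINT x:ball a r|\<mu>. norm (f x) powr p)"
proof -
  have "set_integrable \<mu> (cball a r) (\<lambda>x. norm (f x) powr p)"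
    using f by (auto simp: Lp_loc_def)
  then have "set_integrable \<mu> (ball a r) (\<lambda>x. norm (f x) powr p)"
    by (rule set_integrable_subset) (auto simp: sets_eq_borel)
  then have "(\<integral>\<^sup>+x. ennreal (indicat_real (ball a r) x *\<^sub>R norm (f x) powr p) \<partial>\<mu>)
      = ennreal (LINT x:ball a r|\<mu>. norm (f x) powr p)"
    unfolding set_integrable_def set_lebesgue_integral_def
    by (intro nn_integral_eq_integral) auto
  moreover have "(\<integral>\<^sup>+x\<in>ball a r. ennreal (norm (f x) powr p) \<partial>\<mu>)
      = (\<integral>\<^sup>+x. ennreal (indicat_real (ball a r) x *\<^sub>R norm (f x) powr p) \<partial>\<mu>)"
    by (intro nn_integral_cong) (auto simp: indicator_def)
  ultimately show ?thesis
    by simp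
qed

lemma morrey_seminorm_le_iff:
  fixes f :: "'a \<Rightarrow> 'k::{real_normed_field, euclidean_space}"
  assumes f: "f \<in> Lp_loc p \<mu>" and c: "0 \<le> c"
  shows "morrey_seminorm n p \<phi> \<mu> f \<le> ennreal c \<longleftrightarrow> morrey_bound c f"
proof -
  have pos: "0 \<le> (LINT x:ball a r|\<mu>. norm (f x) powr p)" for a r
    unfolding set_lebesgue_integral_def by (intro integral_nonneg_AE) auto
  have "morrey_seminorm n p \<phi> \<mu> f \<le> ennreal c \<longleftrightarrow>
     (\<forall>a r. 0 < r \<longrightarrow> 1 / \<phi> r * (1 / r powr n * (LINT x:ball a r|\<mu>. norm (f x) powr p)) powr (1 / p) \<le> c)"
    using c unfolding morrey_seminorm_def by (auto simp: SUP_le_iff ennreal_le_iff)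
  also have "\<dots> \<longleftrightarrow> (\<forall>a r. 0 < r \<longrightarrow>
      (LINT x:ball a r|\<mu>. norm (f x) powr p) \<le> (c * \<phi> r * r powr (n / p)) powr p)"
    by (auto simp: ball_bound_iff[OF p_ge_1 _ phi_pos c pos] simp del: times_divide_eq_left)
  also have "\<dots> \<longleftrightarrow> morrey_bound c f"
    using f by (auto simp: morrey_bound_def nn_integral_ball_eq[OF f] ennreal_le_iff Lp_loc_def)
  finally show ?thesis .
qed

lemma morrey_bound_imp_mem:
  assumes "morrey_bound c f" "0 \<le> c"
  shows "f \<in> morreys"
  using morrey_seminorm_le_iff[of f c] assms
  by (auto simp: morrey_functions_def morrey_bound_imp_Lp_loc intro: order_le_less_trans)

text \<open>The bridge between the norm and the ball estimates: all later inequalities for the norm are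
  proved for \<open>morrey_bound\<close> and transferred by this equivalence.\<close>

lemma morrey_value_le_iff:
  assumes f: "f \<in> morreys" and c: "0 \<le> c"
  shows "morrey_value f \<le> c \<longleftrightarrow> morrey_bound c f"
proof -
  have "morrey_seminorm n p \<phi> \<mu> f = ennreal (morrey_value f)"
    using f by (simp add: morrey_value_def morrey_functions_def)
  then show ?thesis
    using morrey_seminorm_le_iff[of f c] f c
    by (simp add: morrey_functions_def ennreal_le_iff)
qed

lemma morrey_bound_value: "f \<in> morreys \<Longrightarrow> morrey_bound (morrey_value f) f"
  using morrey_value_le_iff[of f "morrey_value f"] by (simp add: morrey_value_nonneg)

lemma morreys_measurable: "f \<in> morreys \<Longrightarrow> f \<in> borel_measurable \<mu>"
  by (simp add: morrey_functions_def Lp_loc_def)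

lemma morrey_bound_mono:
  assumes "morrey_bound c f" "0 \<le> c" "c \<le> d"
  shows "morrey_bound d f"
proof -
  have f: "f \<in> morreys"
    using assms by (intro morrey_bound_imp_mem)
  show ?thesis
    using assms morrey_value_le_iff[OF f, of c] morrey_value_le_iff[OF f, of d] by simp
qed

lemma morrey_bound_zero: "morrey_bound 0 (\<lambda>x. 0)"
  using p_ge_1 by (simp add: morrey_bound_def)

text \<open>Minkowski's inequality on each ball; the common factor \<open>\<phi>(r) r\<^bsup>n/p\<^esup>\<close> of the two bounds can be
  taken out.\<close>

lemma morrey_bound_add:
  assumes f: "morrey_bound c f" and g: "morrey_bound d g" and "0 < c" "0 < d"
  shows "morrey_bound (c + d) (\<lambda>x. f x + g x)"
  unfolding morrey_bound_def
proof (intro conjI allI impI)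
  have [measurable]: "f \<in> borel_measurable \<mu>" "g \<in> borel_measurable \<mu>"
    using f g by (auto dest: morrey_bound_measurable)
  show "(\<lambda>x. f x + g x) \<in> borel_measurable \<mu>"
    by measurable
  fix a :: 'a and r :: real
  assume r: "0 < r"
  have "(\<integral>\<^sup>+x\<in>ball a r. ennreal (norm (f x + g x) powr p) \<partial>\<mu>)
      \<le> ennreal ((c * \<phi> r * r powr (n / p) + d * \<phi> r * r powr (n / p)) powr p)"
    using assms r phi_pos[OF r]
    by (intro nn_integral_powr_norm_add_le p_ge_1 morrey_boundD) (auto simp: sets_eq_borel)
  then show "(\<integral>\<^sup>+x\<in>ball a r. ennreal (norm (f x + g x) powr p) \<partial>\<mu>)
      \<le> ennreal (((c + d) * \<phi> r * r powr (n / p)) powr p)"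
    by (simp add: algebra_simps)
qed

lemma morrey_bound_mult:
  assumes f: "morrey_bound c f" and c: "0 \<le> c"
  shows "morrey_bound (norm k * c) (\<lambda>x. k * f x)"
  unfolding morrey_bound_def
proof (intro conjI allI impI)
  have [measurable]: "f \<in> borel_measurable \<mu>"
    using f by (rule morrey_bound_measurable)
  show "(\<lambda>x. k * f x) \<in> borel_measurable \<mu>"
    by measurable
  fix a :: 'a and r :: real
  assume r: "0 < r"
  have "(\<integral>\<^sup>+x\<in>ball a r. ennreal (norm (k * f x) powr p) \<partial>\<mu>)
      = (\<integral>\<^sup>+x. ennreal (norm k powr p) * (ennreal (norm (f x) powr p) * indicator (ball a r) x) \<partial>\<mu>)"
    by (intro nn_integral_cong) (auto simp: norm_mult powr_mult ennreal_mult indicator_def)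
  also have "\<dots> = ennreal (norm k powr p) * (\<integral>\<^sup>+x\<in>ball a r. ennreal (norm (f x) powr p) \<partial>\<mu>)"
    by (intro nn_integral_cmult) (auto simp: sets_eq_borel)
  also have "\<dots> \<le> ennreal (norm k powr p) * ennreal ((c * \<phi> r * r powr (n / p)) powr p)"
    using f r by (intro mult_left_mono morrey_boundD) auto
  also have "\<dots> = ennreal ((norm k * c * \<phi> r * r powr (n / p)) powr p)"
    using c phi_pos[OF r] by (simp add: ennreal_mult[symmetric] powr_mult[symmetric] mult.assoc)
  finally show "(\<integral>\<^sup>+x\<in>ball a r. ennreal (norm (k * f x) powr p) \<partial>\<mu>)
      \<le> ennreal ((norm k * c * \<phi> r * r powr (n / p)) powr p)" .
qed

lemma morrey_bound_cong_AE:
  assumes f: "morrey_bound c f" and g: "g \<in> borel_measurable \<mu>" and eq: "AE x in \<mu>. f x = g x"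
  shows "morrey_bound c g"
  unfolding morrey_bound_def
proof (intro conjI allI impI)
  fix a :: 'a and r :: real
  assume r: "0 < r"
  have "(\<integral>\<^sup>+x\<in>ball a r. ennreal (norm (g x) powr p) \<partial>\<mu>)
      = (\<integral>\<^sup>+x\<in>ball a r. ennreal (norm (f x) powr p) \<partial>\<mu>)"
    using eq by (intro nn_integral_cong_AE) auto
  then show "(\<integral>\<^sup>+x\<in>ball a r. ennreal (norm (g x) powr p) \<partial>\<mu>)
      \<le> ennreal ((c * \<phi> r * r powr (n / p)) powr p)"
    using morrey_boundD[OF f r] by simp
qed (rule g)

text \<open>The balls with integer radius around the origin are a countable cover.\<close>

lemma AE_if_AE_ball:
  assumes "\<And>r. 0 < r \<Longrightarrow> AE x in \<mu>. x \<in> ball 0 r \<longrightarrow> P x"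
  shows "AE x in \<mu>. P x"
proof -
  have "AE x in \<mu>. \<forall>m::nat. x \<in> ball 0 (real (Suc m)) \<longrightarrow> P x"
    unfolding AE_all_countable by (intro allI assms) simp
  then show ?thesis
  proof (rule AE_mp, intro AE_I2 impI)
    fix x
    assume *: "\<forall>m::nat. x \<in> ball 0 (real (Suc m)) \<longrightarrow> P x"
    obtain m :: nat where "norm x < real m"
      using reals_Archimedean2 by blast
    then show "P x"
      using *[rule_format, of m] by simp
  qed
qed

lemma morrey_bound_0_iff:
  fixes f :: "'a \<Rightarrow> 'k::{real_normed_field, euclidean_space}"
  assumes [measurable]: "f \<in> borel_measurable \<mu>"
  shows "morrey_bound 0 f \<longleftrightarrow> (AE x in \<mu>. f x = 0)"
proof
  assume f: "morrey_bound 0 f"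
  show "AE x in \<mu>. f x = 0"
  proof (rule AE_if_AE_ball)
    fix r :: real
    assume r: "0 < r"
    have "(\<integral>\<^sup>+x\<in>ball 0 r. ennreal (norm (f x) powr p) \<partial>\<mu>) = 0"
      using morrey_boundD[OF f r, of 0] by simp
    then have "AE x in \<mu>. ennreal (norm (f x) powr p) * indicator (ball 0 r) x = 0"
      by (subst (asm) nn_integral_0_iff_AE) (auto simp: sets_eq_borel)
    then show "AE x in \<mu>. x \<in> ball 0 r \<longrightarrow> f x = 0"
      by (rule AE_mp) (auto simp: indicator_def)
  qed
next
  assume "AE x in \<mu>. f x = 0"
  then show "morrey_bound 0 f"
    by (intro morrey_bound_cong_AE[OF morrey_bound_zero]) auto
qed

section \<open>Limits of sequences with Morrey bounds\<close>

text \<open>Fatou's lemma on each ball: closed norm balls of the Morrey space are stable under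
  convergence almost everywhere.\<close>

lemma morrey_bound_tendsto_AE:
  fixes h :: "nat \<Rightarrow> 'a \<Rightarrow> 'k::{real_normed_field, euclidean_space}"
  assumes h: "\<And>i. morrey_bound c (h i)"
    and g: "g \<in> borel_measurable \<mu>"
    and lim: "AE x in \<mu>. (\<lambda>i. h i x) \<longlonglongrightarrow> g x"
  shows "morrey_bound c g"
  unfolding morrey_bound_def
proof (intro conjI allI impI)
  have [measurable]: "h i \<in> borel_measurable \<mu>" for i
    using h by (rule morrey_bound_measurable)
  fix a :: 'a and r :: real
  assume r: "0 < r"
  have "(\<integral>\<^sup>+x\<in>ball a r. ennreal (norm (g x) powr p) \<partial>\<mu>)
      = (\<integral>\<^sup>+x. liminf (\<lambda>i. ennreal (norm (h i x) powr p) * indicator (ball a r) x) \<partial>\<mu>)"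
  proof (intro nn_integral_cong_AE, use lim in \<open>rule AE_mp\<close>, intro AE_I2 impI)
    fix x
    assume "(\<lambda>i. h i x) \<longlonglongrightarrow> g x"
    then have "(\<lambda>i. norm (h i x) powr p) \<longlonglongrightarrow> norm (g x) powr p"
      using p_ge_1 by (intro tendsto_powr' tendsto_norm tendsto_const) auto
    then have "(\<lambda>i. ennreal (norm (h i x) powr p) * indicator (ball a r) x)
        \<longlonglongrightarrow> ennreal (norm (g x) powr p) * indicator (ball a r) x"
      by (cases "x \<in> ball a r") (auto simp: tendsto_ennrealI)
    then show "ennreal (norm (g x) powr p) * indicator (ball a r) x
        = liminf (\<lambda>i. ennreal (norm (h i x) powr p) * indicator (ball a r) x)"
      by (simp add: lim_imp_Liminf)
  qed
  also have "\<dots> \<le> liminf (\<lambda>i. \<integral>\<^sup>+x\<in>ball a r. ennreal (norm (h i x) powr p) \<partial>\<mu>)"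
    by (intro nn_integral_liminf) (auto simp: sets_eq_borel)
  also have "\<dots> \<le> liminf (\<lambda>i::nat. ennreal ((c * \<phi> r * r powr (n / p)) powr p))"
    by (intro Liminf_mono always_eventually allI morrey_boundD[OF h r])
  also have "\<dots> = ennreal ((c * \<phi> r * r powr (n / p)) powr p)"
    by (simp add: Liminf_const)
  finally show "(\<integral>\<^sup>+x\<in>ball a r. ennreal (norm (g x) powr p) \<partial>\<mu>)
      \<le> ennreal ((c * \<phi> r * r powr (n / p)) powr p)" .
qed (rule g)

lemma convergent_if_summable_norm_diff:
  fixes h :: "nat \<Rightarrow> 'k::banach"
  assumes "summable (\<lambda>j. norm (h (Suc j) - h j))"
  shows "convergent h"
proof -
  have "convergent (\<lambda>m. \<Sum>j<m. h (Suc j) - h j)"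
    using summable_norm_cancel[OF assms] by (simp add: summable_iff_convergent)
  then have "convergent (\<lambda>m. h m - h 0)"
    by (simp add: sum_lessThan_telescope)
  from convergent_add[OF this convergent_const[of "h 0"]] show ?thesis
    by simp
qed

text \<open>The rate \<open>4\<^bsup>-j\<^esup>\<close> leaves room for the weights \<open>2\<^sup>j\<close>: even after multiplication by them the
  \<open>p\<close>-th powers of the differences have summable integrals over a ball. A finite sum bounds each
  of its terms, so the differences themselves decay like \<open>2\<^bsup>-j\<^esup>\<close>.\<close>

lemma AE_convergent_if_rapidly_Cauchy:
  fixes h :: "nat \<Rightarrow> 'a \<Rightarrow> 'k::{real_normed_field, euclidean_space}"
  assumes [measurable]: "\<And>j. h j \<in> borel_measurable \<mu>"
    and h: "\<And>j. morrey_bound ((1 / 4) ^ j) (\<lambda>x. h (Suc j) x - h j x)"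
  shows "AE x in \<mu>. convergent (\<lambda>j. h j x)"
proof (rule AE_if_AE_ball)
  fix r :: real
  assume r: "0 < r"
  define w where "w = (\<phi> r * r powr (n / p)) powr p"
  define u where "u j x = ennreal ((2 ^ j * norm (h (Suc j) x - h j x)) powr p) * indicator (ball 0 r) x" for j x
  have [measurable]: "u j \<in> borel_measurable \<mu>" for j
    unfolding u_def by (measurable; simp add: sets_eq_borel)
  have int_u: "(\<integral>\<^sup>+x. u j x \<partial>\<mu>) \<le> ennreal (w * (1 / 2) ^ j)" for j
  proof -
    have "(\<integral>\<^sup>+x. u j x \<partial>\<mu>)
        = (\<integral>\<^sup>+x. ennreal ((2 ^ j) powr p) * (ennreal (norm (h (Suc j) x - h j x) powr p) * indicator (ball 0 r) x) \<partial>\<mu>)"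
      unfolding u_def by (intro nn_integral_cong) (auto simp: powr_mult ennreal_mult indicator_def)
    also have "\<dots> = ennreal ((2 ^ j) powr p) * (\<integral>\<^sup>+x\<in>ball 0 r. ennreal (norm (h (Suc j) x - h j x) powr p) \<partial>\<mu>)"
      by (intro nn_integral_cmult) (measurable; simp add: sets_eq_borel)
    also have "\<dots> \<le> ennreal ((2 ^ j) powr p) * ennreal (((1 / 4) ^ j * \<phi> r * r powr (n / p)) powr p)"
      using morrey_boundD[OF h r] by (intro mult_left_mono) auto
    also have "\<dots> = ennreal ((2 ^ j * ((1 / 4) ^ j * \<phi> r * r powr (n / p))) powr p)"
      using phi_pos[OF r] by (simp add: ennreal_mult[symmetric] powr_mult[symmetric])
    also have "2 ^ j * ((1 / 4) ^ j * \<phi> r * r powr (n / p)) = (1 / 2) ^ j * (\<phi> r * r powr (n / p))"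
      by (simp add: power_mult_distrib[symmetric] mult.assoc[symmetric] del: power_divide) 
    also have "((1 / 2) ^ j * (\<phi> r * r powr (n / p))) powr p = ((1 / 2) ^ j) powr p * w"
      using phi_pos[OF r] by (simp add: w_def powr_mult)
    \<comment> \<open>As \<open>p \<ge> 1\<close>, the power \<open>p\<close> does not enlarge \<open>2\<^bsup>-j\<^esup>\<close>; a geometric series remains.\<close>
    also have "\<dots> \<le> (1 / 2) ^ j * w"
      using p_ge_1 by (intro mult_right_mono powr_le_one_le power_le_one) (auto simp: w_def)
    finally show ?thesis
      by (simp add: mult.commute ennreal_leI)
  qed
  have "(\<integral>\<^sup>+x. (\<Sum>j. u j x) \<partial>\<mu>) = (\<Sum>j. \<integral>\<^sup>+x. u j x \<partial>\<mu>)"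
    by (intro nn_integral_suminf) measurable
  also have "\<dots> \<le> (\<Sum>j. ennreal (w * (1 / 2) ^ j))"
    by (intro suminf_le int_u summableI)
  also have "\<dots> = ennreal (\<Sum>j. w * (1 / 2) ^ j)"
    by (intro suminf_ennreal2 summable_mult summable_geometric) (auto simp: w_def)
  finally have "(\<integral>\<^sup>+x. (\<Sum>j. u j x) \<partial>\<mu>) \<noteq> \<infinity>"
    by (auto simp: top_unique)
  then have "AE x in \<mu>. (\<Sum>j. u j x) \<noteq> \<infinity>"
    by (intro nn_integral_PInf_AE) measurable
  then show "AE x in \<mu>. x \<in> ball 0 r \<longrightarrow> convergent (\<lambda>j. h j x)"
  proof (rule AE_mp, intro AE_I2 impI)
    fix x
    assume fin: "(\<Sum>j. u j x) \<noteq> \<infinity>" and x: "x \<in> ball 0 r"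
    obtain T where T: "(\<Sum>j. u j x) = ennreal T" "0 \<le> T"
      using fin by (cases "\<Sum>j. u j x") auto
    have le: "norm (h (Suc j) x - h j x) \<le> T powr (1 / p) * (1 / 2) ^ j" for j
    proof -
      define y where "y = 2 ^ j * norm (h (Suc j) x - h j x)"
      have "u j x \<le> ennreal T"
        using sum_le_suminf[OF summableI, of "{j}" "\<lambda>j. u j x"] T by simp
      then have "y powr p \<le> T"
        using x T by (simp add: u_def y_def ennreal_le_iff)
      then have "(y powr p) powr (1 / p) \<le> T powr (1 / p)"
        using p_ge_1 by (intro powr_mono2) auto
      then have "y \<le> T powr (1 / p)"
        using p_ge_1 by (simp add: powr_powr y_def)
      then show ?thesis
        by (simp add: y_def field_simps)
    qed
    have "summable (\<lambda>j. T powr (1 / p) * (1 / 2) ^ j)"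
      by (intro summable_mult summable_geometric) simp
    then have "summable (\<lambda>j. norm (h (Suc j) x - h j x))"
      by (rule summable_comparison_test'[of _ 0]) (use le in simp)
    then show "convergent (\<lambda>j. h j x)"
      by (rule convergent_if_summable_norm_diff)
  qed
qed

section \<open>Norm properties for functions\<close>

lemma morreys_zero: "(\<lambda>x. 0) \<in> morreys"
  using morrey_bound_zero by (rule morrey_bound_imp_mem) simp

lemma morreys_mult:
  assumes "f \<in> morreys"
  shows "(\<lambda>x. k * f x) \<in> morreys"
  using morrey_bound_mult[OF morrey_bound_value[OF assms] morrey_value_nonneg]
  by (rule morrey_bound_imp_mem) (simp add: morrey_value_nonneg)

lemma
  assumes f: "f \<in> morreys" and g: "g \<in> morreys"
  shows morreys_add: "(\<lambda>x. f x + g x) \<in> morreys"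
    and morrey_value_add_le: "morrey_value (\<lambda>x. f x + g x) \<le> morrey_value f + morrey_value g"
proof -
  \<comment> \<open>The slack \<open>e\<close> makes both bounds positive, as the sum rule for bounds requires.\<close>
  have *: "morrey_bound (morrey_value f + e + (morrey_value g + e)) (\<lambda>x. f x + g x)"
    if "0 < e" for e
    using that morrey_value_nonneg[of f] morrey_value_nonneg[of g]
    by (intro morrey_bound_add morrey_bound_mono[OF morrey_bound_value] f g) auto
  show mem: "(\<lambda>x. f x + g x) \<in> morreys"
    using *[of 1] morrey_value_nonneg[of f] morrey_value_nonneg[of g]
    by (intro morrey_bound_imp_mem[OF *[of 1]]) auto
  show "morrey_value (\<lambda>x. f x + g x) \<le> morrey_value f + morrey_value g"
  proof (rule field_le_epsilon)
    fix e :: real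
    assume "0 < e"
    then show "morrey_value (\<lambda>x. f x + g x) \<le> morrey_value f + morrey_value g + e"
      using *[of "e / 2"] morrey_value_nonneg[of f] morrey_value_nonneg[of g]
      by (subst morrey_value_le_iff[OF mem]) (auto simp: algebra_simps)
  qed
qed

lemma morreys_diff:
  assumes "f \<in> morreys" "g \<in> morreys"
  shows "(\<lambda>x. f x - g x) \<in> morreys"
  using morreys_add[OF assms(1) morreys_mult[OF assms(2), of "- 1"]] by simp

lemma morrey_value_mult:
  assumes f: "f \<in> morreys"
  shows "morrey_value (\<lambda>x. k * f x) = norm k * morrey_value f"
proof -
  \<comment> \<open>The reverse inequality is the same estimate for the inverse scalar.\<close>
  have le: "morrey_value (\<lambda>x. k * g x) \<le> norm k * morrey_value g" if g: "g \<in> morreys"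
    for k and g :: "'a \<Rightarrow> 'b"
    using morrey_bound_mult[OF morrey_bound_value[OF g] morrey_value_nonneg]
    by (subst morrey_value_le_iff[OF morreys_mult[OF g]]) (auto simp: morrey_value_nonneg)
  show ?thesis
  proof (cases "k = 0")
    case True
    then show ?thesis
      using le[OF f, of k] morrey_value_nonneg[of "\<lambda>x. k * f x"] by simp
  next
    case False
    have "morrey_value f = morrey_value (\<lambda>x. inverse k * (k * f x))"
      using False by (simp add: mult.assoc[symmetric])
    also have "\<dots> \<le> norm (inverse k) * morrey_value (\<lambda>x. k * f x)"
      by (intro le morreys_mult f)
    finally have "morrey_value f \<le> morrey_value (\<lambda>x. k * f x) / norm k"
      by (simp add: norm_inverse divide_inverse_commute)
    then have "norm k * morrey_value f \<le> morrey_value (\<lambda>x. k * f x)"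
      using False by (simp add: pos_le_divide_eq mult.commute)
    with le[OF f, of k] show ?thesis
      by (rule antisym)
  qed
qed

lemma morrey_value_cong_AE:
  assumes f: "f \<in> morreys" and g: "g \<in> morreys" and eq: "AE x in \<mu>. f x = g x"
  shows "morrey_value f = morrey_value g"
proof -
  have le: "morrey_value v \<le> morrey_value u"
    if "u \<in> morreys" "v \<in> morreys" "AE x in \<mu>. u x = v x" for u v :: "'a \<Rightarrow> 'b"
    using morrey_bound_cong_AE[OF morrey_bound_value[OF that(1)] morreys_measurable[OF that(2)] that(3)]
    by (simp add: morrey_value_le_iff that(2) morrey_value_nonneg)
  show ?thesis
    using le[OF g f] le[OF f g] eq by (simp add: eq_commute)
qed

lemma morrey_value_eq_0_iff:
  assumes f: "f \<in> morreys"
  shows "morrey_value f = 0 \<longleftrightarrow> (AE x in \<mu>. f x = 0)"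
  using morrey_value_le_iff[OF f, of 0] morrey_bound_0_iff[OF morreys_measurable[OF f]]
    morrey_value_nonneg[of f] by auto

section \<open>Completeness for functions\<close>

text \<open>The pointwise limit is taken along indices \<open>R j\<close> from which on the members of the sequence differ by
  less than \<open>4\<^bsup>-j\<^esup>\<close> in norm. The bounds of \<open>f\<^sub>m - f\<^bsub>R j\<^esub>\<close>, which hold for all large \<open>j\<close>, survive in the
  limit, so that the whole sequence converges and not just the selected one.\<close>

lemma morreys_Cauchy_converges:
  fixes f :: "nat \<Rightarrow> 'a \<Rightarrow> 'k::{real_normed_field, euclidean_space}"
  assumes f: "\<And>k. f k \<in> morreys"
    and Cauchy: "\<And>e. 0 < e \<Longrightarrow> \<exists>N. \<forall>m\<ge>N. \<forall>k\<ge>N. morrey_value (\<lambda>x. f m x - f k x) < e"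
  shows "\<exists>g\<in>morreys. \<forall>e>0. \<exists>N. \<forall>m\<ge>N. morrey_value (\<lambda>x. f m x - g x) < e"
proof -
  have [measurable]: "f k \<in> borel_measurable \<mu>" for k
    using f by (rule morreys_measurable)
  have "\<forall>j. \<exists>N. \<forall>m\<ge>N. \<forall>k\<ge>N. morrey_value (\<lambda>x. f m x - f k x) < (1 / 4) ^ j"
    by (intro allI Cauchy) simp
  then obtain N where N:
    "\<And>j m k. N j \<le> m \<Longrightarrow> N j \<le> k \<Longrightarrow> morrey_value (\<lambda>x. f m x - f k x) < (1 / 4) ^ j"
    by metis
  \<comment> \<open>Partial sums turn the thresholds \<open>N j\<close> into a nondecreasing sequence lying above them.\<close>
  define R where "R j = sum N {..j}" for j
  have R: "N i \<le> R j" if "i \<le> j" for i j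
    unfolding R_def using that by (intro member_le_sum) auto
  have bound: "morrey_bound ((1 / 4) ^ i) (\<lambda>x. f m x - f (R j) x)" if "N i \<le> m" "i \<le> j" for i j m
    using N[OF that(1) R[OF that(2)]]
    by (subst morrey_value_le_iff[symmetric]) (auto intro: morreys_diff f)
  \<comment> \<open>Where the sequence diverges \<open>lim\<close> is an unspecified value, but such points form a null set.\<close>
  define g where "g x = lim (\<lambda>j. f (R j) x)" for x
  have [measurable]: "g \<in> borel_measurable \<mu>"
    unfolding g_def by measurable
  have "AE x in \<mu>. convergent (\<lambda>j. f (R j) x)"
    by (rule AE_convergent_if_rapidly_Cauchy) (auto intro!: bound R)
  then have lim: "AE x in \<mu>. (\<lambda>j. f (R j) x) \<longlonglongrightarrow> g x"
    by (rule AE_mp) (auto simp: g_def convergent_LIMSEQ_iff)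
  have diff: "morrey_bound ((1 / 4) ^ i) (\<lambda>x. f m x - g x)" if "N i \<le> m" for i m
  proof (rule morrey_bound_tendsto_AE)
    show "morrey_bound ((1 / 4) ^ i) (\<lambda>x. f m x - f (R (j + i)) x)" for j
      using that by (intro bound) auto
    show "AE x in \<mu>. (\<lambda>j. f m x - f (R (j + i)) x) \<longlonglongrightarrow> f m x - g x"
      using lim by (rule AE_mp) (auto intro!: tendsto_intros LIMSEQ_ignore_initial_segment[where f="\<lambda>j. f (R j) _"])
  qed measurable
  have diff_mem: "(\<lambda>x. f m x - g x) \<in> morreys" if "N i \<le> m" for i m
    using diff[OF that] by (rule morrey_bound_imp_mem) simp
  show ?thesis
  proof (intro bexI allI impI)
    \<comment> \<open>\<open>g = f m - (f m - g)\<close> for an \<open>m\<close> so large that \<open>f m - g\<close> has a bound.\<close>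
    show "g \<in> morreys"
      using morreys_diff[OF f[of "N 0"] diff_mem[of 0 "N 0"]] by simp
    fix e :: real
    assume "0 < e"
    then obtain i where i: "(1 / 4) ^ i < e"
      using real_arch_pow_inv[of e "1 / 4"] by auto
    have "morrey_value (\<lambda>x. f m x - g x) < e" if "N i \<le> m" for m
      using morrey_value_le_iff[OF diff_mem[OF that], of "(1 / 4) ^ i"] diff[OF that] i by simp
    then show "\<exists>N. \<forall>m\<ge>N. morrey_value (\<lambda>x. f m x - g x) < e"
      by blast
  qed
qed


section \<open>Passing to equivalence classes\<close>

definition morrey_class ::
  "('a \<Rightarrow> 'k::{real_normed_field, euclidean_space}) \<Rightarrow> ('a \<Rightarrow> 'k) set" where
  "morrey_class f = morrey_rel n p \<phi> \<mu> `` {f}"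

lemma equiv_morrey_rel: "equiv morreys (morrey_rel n p \<phi> \<mu>)"
proof (rule equivI)
  show "trans (morrey_rel n p \<phi> \<mu>)"
  proof (rule transI)
    fix f g h
    assume *: "(f, g) \<in> morrey_rel n p \<phi> \<mu>" "(g, h) \<in> morrey_rel n p \<phi> \<mu>"
    then have "AE x in \<mu>. f x = g x" "AE x in \<mu>. g x = h x"
      by (auto simp: morrey_rel_def)
    then have "AE x in \<mu>. f x = h x"
      by eventually_elim simp
    with * show "(f, h) \<in> morrey_rel n p \<phi> \<mu>"
      by (auto simp: morrey_rel_def)
  qed
qed (auto simp: morrey_rel_def refl_on_def sym_def eq_commute)

lemma morrey_class_eq_iff:
  assumes "f \<in> morreys" "g \<in> morreys"
  shows "morrey_class f = morrey_class g \<longleftrightarrow> (AE x in \<mu>. f x = g x)"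
  using eq_equiv_class_iff[OF equiv_morrey_rel assms] assms
  by (simp add: morrey_rel_def morrey_class_def)

lemma mem_morrey_class:
  "f \<in> morreys \<Longrightarrow> g \<in> morrey_class f \<longleftrightarrow> g \<in> morreys \<and> (AE x in \<mu>. f x = g x)"
  by (auto simp: morrey_rel_def morrey_class_def)

lemma morrey_class_self: "f \<in> morreys \<Longrightarrow> f \<in> morrey_class f"
  by (simp add: mem_morrey_class)

lemma carrier_morrey_space: "carrier (morrey_space n p \<phi> \<mu>) = morrey_class ` morreys"
  by (auto simp: morrey_space_def quotient_def morrey_class_def)

lemma zero_morrey_space: "\<zero>\<^bsub>morrey_space n p \<phi> \<mu>\<^esub> = morrey_class (\<lambda>x. 0)"
  by (simp add: morrey_space_def morrey_class_def)

lemma add_morrey_class: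
  assumes f: "f \<in> morreys" and g: "g \<in> morreys"
  shows "morrey_class f \<oplus>\<^bsub>morrey_space n p \<phi> \<mu>\<^esub> morrey_class g = morrey_class (\<lambda>x. f x + g x)"
proof -
  have "morrey_class (\<lambda>x. f' x + g' x) = morrey_class (\<lambda>x. f x + g x)"
    if "f' \<in> morrey_class f" "g' \<in> morrey_class g" for f' g'
  proof -
    have "f' \<in> morreys" "g' \<in> morreys" and eq: "AE x in \<mu>. f x = f' x" "AE x in \<mu>. g x = g' x"
      using that by (auto simp: mem_morrey_class f g)
    moreover have "AE x in \<mu>. f' x + g' x = f x + g x"
      using eq by eventually_elim simp
    ultimately show ?thesis
      by (simp add: morrey_class_eq_iff morreys_add f g)
  qed
  then have "(\<Union>f'\<in>morrey_class f. \<Union>g'\<in>morrey_class g. morrey_class (\<lambda>x. f' x + g' x))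
      = (\<Union>f'\<in>morrey_class f. \<Union>g'\<in>morrey_class g. morrey_class (\<lambda>x. f x + g x))"
    by (intro SUP_cong refl)
  also have "\<dots> = morrey_class (\<lambda>x. f x + g x)"
    using morrey_class_self[OF f] morrey_class_self[OF g] by blast
  finally show ?thesis
    by (simp add: morrey_space_def flip: morrey_class_def)
qed

lemma smult_morrey_class:
  assumes f: "f \<in> morreys"
  shows "k \<odot>\<^bsub>morrey_space n p \<phi> \<mu>\<^esub> morrey_class f = morrey_class (\<lambda>x. k * f x)"
proof -
  have "morrey_class (\<lambda>x. k * f' x) = morrey_class (\<lambda>x. k * f x)" if "f' \<in> morrey_class f" for f'
  proof -
    have f': "f' \<in> morreys" and eq: "AE x in \<mu>. f x = f' x"
      using that by (auto simp: mem_morrey_class f)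
    have "AE x in \<mu>. k * f' x = k * f x"
      using eq by eventually_elim simp
    then show ?thesis
      by (simp add: morrey_class_eq_iff morreys_mult f f')
  qed
  then have "(\<Union>f'\<in>morrey_class f. morrey_class (\<lambda>x. k * f' x))
      = (\<Union>f'\<in>morrey_class f. morrey_class (\<lambda>x. k * f x))"
    by (intro SUP_cong refl)
  also have "\<dots> = morrey_class (\<lambda>x. k * f x)"
    using morrey_class_self[OF f] by blast
  finally show ?thesis
    by (simp add: morrey_space_def flip: morrey_class_def)
qed

lemma morrey_norm_class:
  assumes f: "f \<in> morreys"
  shows "morrey_norm n p \<phi> \<mu> (morrey_class f) = morrey_value f"
proof -
  have "(\<lambda>g. enn2real (morrey_seminorm n p \<phi> \<mu> g)) ` morrey_class f = {morrey_value f}"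
    using morrey_class_self[OF f] morrey_value_cong_AE[OF f]
    unfolding morrey_value_def[symmetric] by (auto simp: mem_morrey_class f)
  then show ?thesis
    by (simp add: morrey_norm_def)
qed

end

lemma cring_scalar_ring: "cring (scalar_ring :: 'k::real_normed_field ring)"
proof (rule cringI)
  show "abelian_group (scalar_ring :: 'k ring)"
  proof (rule abelian_groupI)
    show "\<exists>y\<in>carrier scalar_ring. y \<oplus>\<^bsub>scalar_ring\<^esub> x = \<zero>\<^bsub>scalar_ring\<^esub>"
      for x :: 'k
      by (rule bexI[of _ "- x"]) (auto simp: scalar_ring_def)
  qed (auto simp: scalar_ring_def)
  show "comm_monoid (scalar_ring :: 'k ring)"
    by (rule comm_monoidI) (auto simp: scalar_ring_def)
qed (auto simp: scalar_ring_def algebra_simps)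

lemma (in morrey) module_morrey_space:
  "module scalar_ring
    (morrey_space n p \<phi> \<mu> :: ('k::{real_normed_field, euclidean_space}, ('a \<Rightarrow> 'k) set) module)"
proof (rule moduleI[OF cring_scalar_ring abelian_groupI])
  show "\<exists>y\<in>carrier (morrey_space n p \<phi> \<mu>). y \<oplus>\<^bsub>morrey_space n p \<phi> \<mu>\<^esub> x = \<zero>\<^bsub>morrey_space n p \<phi> \<mu>\<^esub>"
    if x: "x \<in> carrier (morrey_space n p \<phi> \<mu>)" for x :: "('a \<Rightarrow> 'k) set"
  proof -
    obtain f where f: "f \<in> morreys" "x = morrey_class f"
      using x by (auto simp: carrier_morrey_space)
    then show ?thesis
      by (intro bexI[of _ "morrey_class (\<lambda>x. - 1 * f x)"])
         (auto simp: carrier_morrey_space add_morrey_class zero_morrey_space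
           morreys_mult[where k="- 1", simplified])
  qed
qed (auto simp: carrier_morrey_space zero_morrey_space add_morrey_class smult_morrey_class
      morreys_zero morreys_add morreys_mult scalar_ring_def algebra_simps)

lemma (in morrey) normed_space_morrey_space:
  "normed_space
    (morrey_space n p \<phi> \<mu> :: ('k::{real_normed_field, euclidean_space}, ('a \<Rightarrow> 'k) set) module)
    (morrey_norm n p \<phi> \<mu>)"
proof (intro normed_space.intro normed_space_axioms.intro module_morrey_space)
  show "morrey_norm n p \<phi> \<mu> F = 0 \<longleftrightarrow> F = \<zero>\<^bsub>morrey_space n p \<phi> \<mu>\<^esub>"
    if F: "F \<in> carrier (morrey_space n p \<phi> \<mu>)" for F :: "('a \<Rightarrow> 'k) set"
  proof -
    obtain f where "f \<in> morreys" "F = morrey_class f"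
      using F by (auto simp: carrier_morrey_space)
    then show ?thesis
      by (simp add: zero_morrey_space morrey_norm_class morrey_value_eq_0_iff
        morrey_class_eq_iff morreys_zero)
  qed
qed (auto simp: carrier_morrey_space add_morrey_class smult_morrey_class morrey_norm_class
      morreys_add morreys_mult morrey_value_nonneg morrey_value_mult morrey_value_add_le)

lemma (in morrey) banach_space_morrey_space:
  "banach_space
    (morrey_space n p \<phi> \<mu> :: ('k::{real_normed_field, euclidean_space}, ('a \<Rightarrow> 'k) set) module)
    (morrey_norm n p \<phi> \<mu>)"
proof -
  let ?V = "morrey_space n p \<phi> \<mu> :: ('k, ('a \<Rightarrow> 'k) set) module"
  interpret V: normed_space ?V "morrey_norm n p \<phi> \<mu>"
    by (rule normed_space_morrey_space)
  have dist_class: "V.nrm_dist (morrey_class f) (morrey_class g) = morrey_value (\<lambda>x. f x - g x)"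
    if f: "f \<in> morreys" and g: "g \<in> morreys" for f g :: "'a \<Rightarrow> 'k"
  proof -
    have minus: "(\<lambda>x. - g x) \<in> morreys"
      using morreys_mult[OF g, of "- 1"] by simp
    have "\<ominus>\<^bsub>?V\<^esub> morrey_class g = morrey_class (\<lambda>x. - g x)"
      by (rule V.M.minus_equality)
         (auto simp: carrier_morrey_space add_morrey_class zero_morrey_space g minus)
    then show ?thesis
      by (simp add: V.nrm_dist_def carrier_morrey_space a_minus_def add_morrey_class
        morrey_norm_class morreys_diff f g minus)
  qed
  have "V.nrm_metric.mcomplete"
    unfolding V.nrm_metric.mcomplete_def
  proof (intro allI impI)
    fix \<sigma>
    assume \<sigma>: "V.nrm_metric.MCauchy \<sigma>"
    then have "range \<sigma> \<subseteq> carrier ?V"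
      by (simp add: V.nrm_metric.MCauchy_def)
    then have "\<forall>k. \<exists>f\<in>morreys. \<sigma> k = morrey_class f"
      unfolding carrier_morrey_space by blast
    then obtain f where f: "\<And>k. f k \<in> morreys" "\<And>k. \<sigma> k = morrey_class (f k)"
      by metis
    have "\<exists>N. \<forall>m\<ge>N. \<forall>k\<ge>N. morrey_value (\<lambda>x. f m x - f k x) < e" if "0 < e" for e
      using \<sigma> that by (auto simp: V.nrm_metric.MCauchy_def f(2) dist_class[OF f(1) f(1)])
    from morreys_Cauchy_converges[OF f(1) this] obtain g where g: "g \<in> morreys"
      "\<And>e. 0 < e \<Longrightarrow> \<exists>N. \<forall>m\<ge>N. morrey_value (\<lambda>x. f m x - g x) < e"
      by blast
    have "limitin V.nrm_metric.mtopology \<sigma> (morrey_class g) sequentially"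
      unfolding V.nrm_metric.limit_metric_sequentially
      using g f(1) by (auto simp: f(2) dist_class carrier_morrey_space)
    then show "\<exists>x. limitin V.nrm_metric.mtopology \<sigma> x sequentially" ..
  qed
  then show ?thesis
    by (intro banach_space.intro banach_space_axioms.intro normed_space_morrey_space)
qed


section \<open>The Banach space theorem\<close>

theorem theorem2p3:
  fixes \<mu> :: "(real ^ 'd::finite) measure"
    and n p :: real and \<phi> :: "real \<Rightarrow> real"
  assumes "0 < n" and "n \<le> real CARD('d)"
    and "sets \<mu> = sets borel"
    and "growth_condition n \<mu>"
    and "1 \<le> p"
    and "\<phi> \<in> growth_functions n p"
  shows "banach_space
    (morrey_space n p \<phi> \<mu> ::
       ('k::{real_normed_field, euclidean_space}, (real ^ 'd \<Rightarrow> 'k) set) module)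
    (morrey_norm n p \<phi> \<mu>)"
proof -
  interpret morrey n p \<phi> \<mu>
    using assms by unfold_locales (auto simp: growth_functions_def)
  show ?thesis
    by (rule banach_space_morrey_space)
qed

end
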